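(* Let $(G,\zeta)$ be a quandle envelope on a set $Q$ with a fixed element $e\in Q$, with $G$ finite. Then $\mathcal Q(G,\zeta)$ is a latin quandle if and only if for every $\alpha\in G\smallsetminus G_e$ the commutator $[\zeta,\alpha]$ has no fixed points (on $Q$).
   Context: Permutations act on the right, as superscripts: $x^{\alpha\beta}=(x^\alpha)^\beta$; $\alpha^\beta=\beta^{-1}\alpha\beta$ and $[\alpha,\beta]=\alpha^{-1}\beta^{-1}\alpha\beta$. A quandle is a set with a binary operation such that all right translations $R_x:y\mapsto yx$ are automorphisms and $xx=x$ for all $x$; it is latin if all left translations $L_x:y\mapsto xy$ are also permutations. A quandle envelope on $Q$ (with respect to $e$) is a pair $(G,\zeta)$ where $G$ is a transitive permutation group on $Q$, $\zeta\in Z(G_e)$ (the center of the stabilizer $G_e$ of $e$), and $\langle\zeta^G\rangle=G$ (the smallest normal subgroup of $G$ containing $\zeta$ is $G$). The quandle $\mathcal Q(G,\zeta)=(Q,\circ)$ is defined by $x\circ y=x^{\zeta^{\widehat y}}$, where $\widehat y$ is any element of $G$ with $e^{\widehat y}=y$ (the operation does not depend on the choice of $\widehat y$). *)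

theory Defs
  imports "HOL-Algebra.Group_Action" "HOL-Algebra.Generated_Groups"
begin

text \<open>
  Permutations act on the right, so the product \<open>f \<otimes> g\<close> applies \<open>f\<close> first. The library group
  \<^const>\<open>BijGroup\<close> composes in the other order; \<open>sym_right Q\<close> is its opposite. Its elements are the
  bijections of \<open>Q\<close> that are \<^const>\<open>undefined\<close> outside \<open>Q\<close>, so that equality is equality on \<open>Q\<close>.
  The exponent notation \<open>x\<^sup>f\<close> is the plain application \<open>f x\<close>.
\<close>

definition sym_right :: "'a set \<Rightarrow> ('a \<Rightarrow> 'a) monoid" where
  "sym_right Q = \<lparr>carrier = Bij Q,
                 mult = \<lambda>f g. g \<otimes>\<^bsub>BijGroup Q\<^esub> f,
                 one = \<one>\<^bsub>BijGroup Q\<^esub>\<rparr>"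

abbreviation perm_group :: "'a set \<Rightarrow> ('a \<Rightarrow> 'a) set \<Rightarrow> ('a \<Rightarrow> 'a) monoid" where
  "perm_group Q G \<equiv> (sym_right Q)\<lparr>carrier := G\<rparr>"

abbreviation point_stabilizer :: "'a set \<Rightarrow> ('a \<Rightarrow> 'a) set \<Rightarrow> 'a \<Rightarrow> ('a \<Rightarrow> 'a) set" where
  "point_stabilizer Q G e \<equiv> stabilizer (perm_group Q G) (\<lambda>g. g) e"

definition transitive_perm_group :: "'a set \<Rightarrow> ('a \<Rightarrow> 'a) set \<Rightarrow> bool" where
  "transitive_perm_group Q G \<longleftrightarrow>
     subgroup G (sym_right Q) \<and> (\<forall>x\<in>Q. \<forall>y\<in>Q. \<exists>g\<in>G. g x = y)"

definition conjugate :: "('g, 'b) monoid_scheme \<Rightarrow> 'g \<Rightarrow> 'g \<Rightarrow> 'g" where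
  "conjugate G a b = inv\<^bsub>G\<^esub> b \<otimes>\<^bsub>G\<^esub> a \<otimes>\<^bsub>G\<^esub> b"

definition commutator :: "('g, 'b) monoid_scheme \<Rightarrow> 'g \<Rightarrow> 'g \<Rightarrow> 'g" where
  "commutator G a b = inv\<^bsub>G\<^esub> a \<otimes>\<^bsub>G\<^esub> inv\<^bsub>G\<^esub> b \<otimes>\<^bsub>G\<^esub> a \<otimes>\<^bsub>G\<^esub> b"

definition group_center :: "('g, 'b) monoid_scheme \<Rightarrow> 'g set" where
  "group_center G = {z \<in> carrier G. \<forall>g\<in>carrier G. z \<otimes>\<^bsub>G\<^esub> g = g \<otimes>\<^bsub>G\<^esub> z}"

definition normal_closure :: "('g, 'b) monoid_scheme \<Rightarrow> 'g \<Rightarrow> 'g set" where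
  "normal_closure G a = generate G (conjugate G a ` carrier G)"

definition quandle :: "'a set \<Rightarrow> ('a \<Rightarrow> 'a \<Rightarrow> 'a) \<Rightarrow> bool" where
  "quandle Q f \<longleftrightarrow>
     f \<in> Q \<rightarrow> Q \<rightarrow> Q \<and>
     (\<forall>x\<in>Q. bij_betw (\<lambda>y. f y x) Q Q \<and>
             (\<forall>y\<in>Q. \<forall>z\<in>Q. f (f y z) x = f (f y x) (f z x))) \<and>
     (\<forall>x\<in>Q. f x x = x)"

definition latin_quandle :: "'a set \<Rightarrow> ('a \<Rightarrow> 'a \<Rightarrow> 'a) \<Rightarrow> bool" where
  "latin_quandle Q f \<longleftrightarrow> quandle Q f \<and> (\<forall>x\<in>Q. bij_betw (\<lambda>y. f x y) Q Q)"

definition quandle_envelope ::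
    "'a set \<Rightarrow> 'a \<Rightarrow> ('a \<Rightarrow> 'a) set \<Rightarrow> ('a \<Rightarrow> 'a) \<Rightarrow> bool" where
  "quandle_envelope Q e G \<zeta> \<longleftrightarrow>
     e \<in> Q \<and>
     transitive_perm_group Q G \<and>
     \<zeta> \<in> group_center (perm_group Q (point_stabilizer Q G e)) \<and>
     normal_closure (perm_group Q G) \<zeta> = G"

definition envelope_op ::
    "'a set \<Rightarrow> 'a \<Rightarrow> ('a \<Rightarrow> 'a) set \<Rightarrow> ('a \<Rightarrow> 'a) \<Rightarrow> 'a \<Rightarrow> 'a \<Rightarrow> 'a" where
  "envelope_op Q e G \<zeta> x y =
     conjugate (perm_group Q G) \<zeta> (SOME g. g \<in> G \<and> g e = y) x"

lemma sym_right_mult_apply: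
  assumes "f \<in> Bij Q" "g \<in> Bij Q" "x \<in> Q"
  shows "(f \<otimes>\<^bsub>sym_right Q\<^esub> g) x = g (f x)"
  using assms by (simp add: sym_right_def BijGroup_def compose_def)

lemma group_sym_right: "group (sym_right Q)"
proof -
  interpret B: group "BijGroup Q" by (rule group_BijGroup)
  have c: "carrier (BijGroup Q) = Bij Q" by (simp add: BijGroup_def)
  show ?thesis
  proof (rule groupI)
    fix x assume "x \<in> carrier (sym_right Q)"
    then have "x \<in> carrier (BijGroup Q)" by (simp add: sym_right_def c)
    then show "\<exists>y\<in>carrier (sym_right Q). y \<otimes>\<^bsub>sym_right Q\<^esub> x = \<one>\<^bsub>sym_right Q\<^esub>"
      using B.r_inv B.inv_closed unfolding sym_right_def c by auto
  qed (use B.m_closed B.one_closed B.m_assoc B.r_one in \<open>auto simp: sym_right_def c\<close>)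
qed

lemma normal_closure_smallest:
  assumes "group G" and a: "a \<in> carrier G"
  shows "normal_closure G a = \<Inter> {N. N \<lhd> G \<and> a \<in> N}"
proof -
  interpret group G by fact
  let ?C = "conjugate G a ` carrier G"
  have C: "?C \<subseteq> carrier G" using a by (auto simp: conjugate_def)
  have sub: "subgroup (generate G ?C) G" by (rule generate_is_subgroup[OF C])
  have normal: "generate G ?C \<lhd> G"
  proof (rule normal_generateI[OF C])
    fix h g assume "h \<in> ?C" and g: "g \<in> carrier G"
    then obtain b where b: "b \<in> carrier G" "h = conjugate G a b" by auto
    then have "g \<otimes>\<^bsub>G\<^esub> h \<otimes>\<^bsub>G\<^esub> inv\<^bsub>G\<^esub> g = conjugate G a (b \<otimes>\<^bsub>G\<^esub> inv\<^bsub>G\<^esub> g)"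
      using a g by (simp add: conjugate_def inv_mult_group m_assoc)
    then show "g \<otimes>\<^bsub>G\<^esub> h \<otimes>\<^bsub>G\<^esub> inv\<^bsub>G\<^esub> g \<in> ?C" using b g by auto
  qed
  have "conjugate G a \<one>\<^bsub>G\<^esub> = a" using a by (simp add: conjugate_def)
  then have "a \<in> ?C" by (metis image_eqI one_closed)
  then have "a \<in> generate G ?C" by (rule generate.incl)
  moreover have "generate G ?C \<subseteq> N" if N: "N \<lhd> G" "a \<in> N" for N
  proof (rule generate_subgroup_incl)
    show "?C \<subseteq> N" using normal.inv_op_closed1[OF N(1) _ N(2)] by (auto simp: conjugate_def)
    show "subgroup N G" using N(1) by (rule normal_imp_subgroup)
  qed
  ultimately show ?thesis using normal unfolding normal_closure_def by blast
qed

lemma envelope_op_eq: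
  assumes env: "quandle_envelope Q e G \<zeta>" and g: "g \<in> G" "g e = y" and x: "x \<in> Q"
  shows "envelope_op Q e G \<zeta> x y = conjugate (perm_group Q G) \<zeta> g x"
proof -
  let ?S = "sym_right Q" and ?P = "perm_group Q G"
  have sG: "subgroup G ?S" and e: "e \<in> Q"
    using env by (auto simp: quandle_envelope_def transitive_perm_group_def)
  interpret P: group ?P by (rule group.subgroup_imp_group[OF group_sym_right sG])
  have B: "h \<in> Bij Q" if "h \<in> G" for h
    using subgroup.subset[OF sG] that by (auto simp: sym_right_def)
  have app: "(h \<otimes>\<^bsub>?P\<^esub> k) z = k (h z)" if "h \<in> G" "k \<in> G" "z \<in> Q" for h k z
    using sym_right_mult_apply[of h Q k z] B that by simp
  have one: "\<one>\<^bsub>?P\<^esub> z = z" if "z \<in> Q" for z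
    using that by (simp add: sym_right_def BijGroup_def)
  have zG: "\<zeta> \<in> G" and zc: "\<And>s. s \<in> G \<Longrightarrow> s e = e \<Longrightarrow> \<zeta> \<otimes>\<^bsub>?P\<^esub> s = s \<otimes>\<^bsub>?P\<^esub> \<zeta>"
    using env by (auto simp: quandle_envelope_def group_center_def stabilizer_def)
  define h where "h = (SOME h. h \<in> G \<and> h e = y)"
  have h: "h \<in> G" "h e = y" using someI[of "\<lambda>h. h \<in> G \<and> h e = y" g] g by (auto simp: h_def)
  define s where "s = h \<otimes>\<^bsub>?P\<^esub> inv\<^bsub>?P\<^esub> g"
  have ig: "inv\<^bsub>?P\<^esub> g \<in> G" using P.inv_closed g by simp
  have sG': "s \<in> G" using P.m_closed h ig by (simp add: s_def)
  have "s e = (inv\<^bsub>?P\<^esub> g) (g e)" using app h g ig e by (simp add: s_def)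
  also have "\<dots> = (g \<otimes>\<^bsub>?P\<^esub> inv\<^bsub>?P\<^esub> g) e" using app g ig e by simp
  also have "\<dots> = e" using P.r_inv g one e by simp
  finally have comm: "\<zeta> \<otimes>\<^bsub>?P\<^esub> s = s \<otimes>\<^bsub>?P\<^esub> \<zeta>" using zc sG' by blast
  have c: "g \<in> carrier ?P" "h \<in> carrier ?P" "s \<in> carrier ?P" "\<zeta> \<in> carrier ?P"
    using g h sG' zG by auto
  have hs: "h = s \<otimes>\<^bsub>?P\<^esub> g" unfolding s_def using c P.inv_closed P.m_assoc P.l_inv P.r_one by metis
  have "conjugate ?P \<zeta> h = inv\<^bsub>?P\<^esub> g \<otimes>\<^bsub>?P\<^esub> (inv\<^bsub>?P\<^esub> s \<otimes>\<^bsub>?P\<^esub> (\<zeta> \<otimes>\<^bsub>?P\<^esub> s)) \<otimes>\<^bsub>?P\<^esub> g"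
    unfolding conjugate_def hs using c P.inv_closed P.m_assoc P.m_closed P.inv_mult_group by metis
  also have "inv\<^bsub>?P\<^esub> s \<otimes>\<^bsub>?P\<^esub> (\<zeta> \<otimes>\<^bsub>?P\<^esub> s) = \<zeta>"
    unfolding comm using c P.inv_closed P.m_assoc P.l_inv P.l_one by metis
  finally show ?thesis by (simp add: envelope_op_def h_def conjugate_def)
qed

end

theory Submission
  imports Defs
begin

text \<open>
  Every element of \<open>G\<close> is an automorphism of the operation, and \<open>R\<^sub>y = \<zeta>\<^sup>g\<close> with \<open>g e = y\<close> lies in
  \<open>G\<close>; this gives the quandle axioms. Moreover \<open>[\<zeta>, \<alpha>]\<close> sends \<open>w \<circ> e\<close> to \<open>w \<circ> \<alpha> e\<close>, so it has a
  fixed point exactly when some left translation identifies \<open>e\<close> with \<open>\<alpha> e\<close>. By homogeneity, a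
  collision of a left translation can be moved to one involving \<open>e\<close>. Hence the commutator condition
  says that all left translations are injective, which suffices because \<open>Q\<close>, an orbit of \<open>G\<close>, is
  finite.
\<close>

text \<open>Group laws in pointwise form, so that simp can calculate with permutations applied to
  points of \<open>Q\<close>.\<close>

lemma perm_group_facts:
  assumes "subgroup G (sym_right Q)"
  shows perm_group_closed: "\<And>g x. g \<in> G \<Longrightarrow> x \<in> Q \<Longrightarrow> g x \<in> Q"
    and perm_group_bij: "\<And>g. g \<in> G \<Longrightarrow> bij_betw g Q Q"
    and perm_group_mult: "\<And>g h. g \<in> G \<Longrightarrow> h \<in> G \<Longrightarrow> g \<otimes>\<^bsub>sym_right Q\<^esub> h \<in> G"
    and perm_group_mult_apply: "\<And>g h x. g \<in> G \<Longrightarrow> h \<in> G \<Longrightarrow> x \<in> Q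
          \<Longrightarrow> (g \<otimes>\<^bsub>sym_right Q\<^esub> h) x = h (g x)"
    and perm_group_inv: "\<And>g. g \<in> G \<Longrightarrow> inv\<^bsub>perm_group Q G\<^esub> g \<in> G"
    and perm_group_inv_apply: "\<And>g x. g \<in> G \<Longrightarrow> x \<in> Q \<Longrightarrow> (inv\<^bsub>perm_group Q G\<^esub> g) (g x) = x"
    and perm_group_apply_inv: "\<And>g x. g \<in> G \<Longrightarrow> x \<in> Q \<Longrightarrow> g ((inv\<^bsub>perm_group Q G\<^esub> g) x) = x"
proof -
  let ?P = "perm_group Q G"
  interpret P: group ?P by (rule group.subgroup_imp_group[OF group_sym_right assms])
  have B: "h \<in> Bij Q" if "h \<in> G" for h
    using subgroup.subset[OF assms] that by (auto simp: sym_right_def)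
  show bij: "bij_betw g Q Q" if "g \<in> G" for g
    using B[OF that] by (simp add: Bij_def)
  show "g x \<in> Q" if "g \<in> G" "x \<in> Q" for g x
    using bij_betwE[OF bij[OF that(1)]] that(2) by blast
  show "g \<otimes>\<^bsub>sym_right Q\<^esub> h \<in> G" if "g \<in> G" "h \<in> G" for g h
    using P.m_closed that by simp
  show app: "(g \<otimes>\<^bsub>sym_right Q\<^esub> h) x = h (g x)" if "g \<in> G" "h \<in> G" "x \<in> Q" for g h x
    using sym_right_mult_apply[of g Q h x] B that by simp
  show iG: "inv\<^bsub>?P\<^esub> g \<in> G" if "g \<in> G" for g
    using P.inv_closed that by simp
  have one: "\<one>\<^bsub>?P\<^esub> x = x" if "x \<in> Q" for x
    using that by (simp add: sym_right_def BijGroup_def)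
  show "(inv\<^bsub>?P\<^esub> g) (g x) = x" if "g \<in> G" "x \<in> Q" for g x
    using P.r_inv[of g] app[of g "inv\<^bsub>?P\<^esub> g" x] iG one that by simp
  show "g ((inv\<^bsub>?P\<^esub> g) x) = x" if "g \<in> G" "x \<in> Q" for g x
    using P.l_inv[of g] app[of "inv\<^bsub>?P\<^esub> g" g x] iG one that by simp
qed

locale envelope =
  fixes Q :: "'a set" and e :: 'a and G :: "('a \<Rightarrow> 'a) set" and \<zeta> :: "'a \<Rightarrow> 'a"
  assumes env: "quandle_envelope Q e G \<zeta>"
begin

abbreviation P where "P \<equiv> perm_group Q G"

abbreviation op where "op \<equiv> envelope_op Q e G \<zeta>"

lemma subgroup: "subgroup G (sym_right Q)"
  and e_in [simp]: "e \<in> Q"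
  and transitive: "x \<in> Q \<Longrightarrow> y \<in> Q \<Longrightarrow> \<exists>g\<in>G. g x = y"
  and \<zeta>_in [simp]: "\<zeta> \<in> G"
  and \<zeta>_fixes [simp]: "\<zeta> e = e"
  using env
  by (auto simp: quandle_envelope_def transitive_perm_group_def group_center_def stabilizer_def)

lemmas [simp] =
  perm_group_closed[OF subgroup] perm_group_mult[OF subgroup] perm_group_mult_apply[OF subgroup]
  perm_group_inv[OF subgroup] perm_group_inv_apply[OF subgroup] perm_group_apply_inv[OF subgroup]

text \<open>The arbitrary choice hidden in \<open>op\<close> gives way to any convenient
  representative \<open>g\<close> of the coset sending \<open>e\<close> to
  \<open>g e\<close>.\<close>

lemma op_apply:
  assumes "g \<in> G" "x \<in> Q"
  shows "op x (g e) = g (\<zeta> ((inv\<^bsub>P\<^esub> g) x))"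
  using envelope_op_eq[OF env assms(1) refl assms(2)] assms by (simp add: conjugate_def)

lemma op_base: "x \<in> Q \<Longrightarrow> op x e = \<zeta> x"
  \<comment> \<open>As \<zeta> fixes \<open>e\<close>, it may serve as the representative itself,
    and its conjugate by itself is \<zeta>.\<close>
  using op_apply[of \<zeta> x] by simp

text \<open>If \<open>g\<close> sends \<open>e\<close> to \<open>y\<close>, then \<open>g\<close>
  followed by \<open>k\<close> sends \<open>e\<close> to \<open>k y\<close>; so right translation by
  \<open>k y\<close> is right translation by \<open>y\<close> conjugated by
  \<open>k\<close>.\<close>

lemma op_hom:
  assumes k: "k \<in> G" and x: "x \<in> Q" and y: "y \<in> Q"
  shows "op (k x) (k y) = k (op x y)"
proof -
  obtain g where g: "g \<in> G" "g e = y" using transitive[of e y] y by force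
  let ?h = "g \<otimes>\<^bsub>sym_right Q\<^esub> k"
  have "(inv\<^bsub>P\<^esub> ?h) (k x) = (inv\<^bsub>P\<^esub> ?h) (?h ((inv\<^bsub>P\<^esub> g) x))"
    using g k x by simp
  \<comment> \<open>The product \<open>?h\<close> must stay folded here, or its inverse would no
    longer cancel against it.\<close>
  also have "\<dots> = (inv\<^bsub>P\<^esub> g) x"
    using g k x by (simp del: perm_group_mult_apply[OF subgroup])
  finally have "op (k x) (?h e) = ?h (\<zeta> ((inv\<^bsub>P\<^esub> g) x))"
    using op_apply[of ?h "k x"] g k x by simp
  then show ?thesis using op_apply[of g x] g k x by simp
qed

lemma op_right_translation:
  assumes "y \<in> Q"
  obtains k where "k \<in> G" "\<And>x. x \<in> Q \<Longrightarrow> op x y = k x"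
proof -
  obtain g where g: "g \<in> G" "g e = y" using transitive[of e y] assms by force
  show thesis
  proof
    show "conjugate P \<zeta> g \<in> G" using g by (simp add: conjugate_def)
    show "op x y = conjugate P \<zeta> g x" if "x \<in> Q" for x
      using envelope_op_eq[OF env g that] .
  qed
qed

lemma op_closed [simp]: "x \<in> Q \<Longrightarrow> y \<in> Q \<Longrightarrow> op x y \<in> Q"
  using op_right_translation[of y] by (metis perm_group_closed[OF subgroup])

text \<open>The case \<open>x = e\<close> holds because \<zeta> fixes \<open>e\<close>; transitivity
  and \<open>op_hom\<close> carry it to every point.\<close>

lemma op_idem:
  assumes "x \<in> Q"
  shows "op x x = x"
proof -
  obtain g where "g \<in> G" "g e = x" using transitive[of e x] assms by force
  then show ?thesis using op_hom[of g e e] op_base[of e] by simp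
qed

lemma quandle_op: "quandle Q op"
  unfolding quandle_def
proof (intro conjI ballI)
  fix x assume x: "x \<in> Q"
  obtain k where k: "k \<in> G" "\<And>y. y \<in> Q \<Longrightarrow> op y x = k y"
    using op_right_translation[OF x] by blast
  show "bij_betw (\<lambda>y. op y x) Q Q"
    using perm_group_bij[OF subgroup k(1)] k(2) bij_betw_cong[of Q "\<lambda>y. op y x" k Q] by simp
  \<comment> \<open>Right translation by \<open>x\<close> agrees on \<open>Q\<close> with
    \<open>k\<close> in \<open>G\<close>, so \<open>op_hom\<close> yields distributivity.\<close>
  show "op (op y z) x = op (op y x) (op z x)" if "y \<in> Q" "z \<in> Q" for y z
    using that k op_hom[of k y z] by simp
qed (auto simp: op_idem)

text \<open>The commutator is the inverse of \<zeta> followed by the conjugate of \<zeta> by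
  \<alpha>: the first factor takes \<open>op w e\<close> back to \<open>w\<close>, the second is
  right translation by \<open>\<alpha> e\<close>.\<close>

lemma commutator_apply:
  assumes "\<alpha> \<in> G" "w \<in> Q"
  shows "commutator P \<zeta> \<alpha> (op w e) = op w (\<alpha> e)"
  using assms by (simp add: commutator_def op_base op_apply)

lemma left_translations_inj_iff:
  "(\<forall>x\<in>Q. inj_on (op x) Q) \<longleftrightarrow>
    (\<forall>\<alpha> \<in> G - point_stabilizer Q G e. \<forall>x\<in>Q. commutator P \<zeta> \<alpha> x \<noteq> x)"
  (is "?L \<longleftrightarrow> ?R")
proof
  assume L: ?L
  show ?R
  proof (intro ballI notI)
    fix \<alpha> x assume "\<alpha> \<in> G - point_stabilizer Q G e" and x: "x \<in> Q"
      and fixed: "commutator P \<zeta> \<alpha> x = x"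
    then have \<alpha>: "\<alpha> \<in> G" "\<alpha> e \<noteq> e" by (auto simp: stabilizer_def)
    \<comment> \<open>Right translation by \<open>e\<close> is \<zeta>, so this \<open>w\<close>
      puts \<open>x\<close> in the form \<open>op w e\<close> that \<open>commutator_apply\<close>
      needs.\<close>
    define w where "w = (inv\<^bsub>P\<^esub> \<zeta>) x"
    have w: "w \<in> Q" "op w e = x" using x by (simp_all add: w_def op_base)
    then have "op w (\<alpha> e) = op w e" using commutator_apply[OF \<alpha>(1) w(1)] fixed by simp
    then show False using L \<alpha> w(1) by (metis e_in inj_onD perm_group_closed[OF subgroup])
  qed
next
  assume R: ?R
  show ?L
  proof (intro ballI inj_onI)
    fix w y z assume w: "w \<in> Q" and y: "y \<in> Q" and z: "z \<in> Q" and eq: "op w y = op w z"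
    \<comment> \<open>Applying \<open>k\<close> turns the collision of \<open>y\<close> and
      \<open>z\<close> under \<open>w\<close> into one of \<open>k y\<close> and \<open>e\<close>
      under \<open>k w\<close>; the \<alpha> chosen next fixes \<open>e\<close> only if
      \<open>k y = k z\<close>.\<close>
    obtain k where k: "k \<in> G" "k z = e" using transitive[of z e] z by force
    obtain \<alpha> where \<alpha>: "\<alpha> \<in> G" "\<alpha> e = k y" using transitive[of e "k y"] k(1) y by auto
    have "op (k w) (\<alpha> e) = op (k w) e"
      using op_hom[of k w y] op_hom[of k w z] k w y z \<alpha>(2) eq by simp
    then have "commutator P \<zeta> \<alpha> (op (k w) e) = op (k w) e"
      using commutator_apply[of \<alpha> "k w"] \<alpha> k w by simp
    moreover have "op (k w) e \<in> Q" using k w by simp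
    ultimately have "\<alpha> \<in> point_stabilizer Q G e" using R \<alpha>(1) by blast
    then have "k y = k z" using \<alpha>(2) k(2) by (simp add: stabilizer_def)
    then show "y = z" using k(1) y z by (metis perm_group_inv_apply[OF subgroup])
  qed
qed

text \<open>By transitivity, evaluation at \<open>e\<close> maps \<open>G\<close> onto
  \<open>Q\<close>.\<close>

lemma finite_carrier:
  assumes "finite G"
  shows "finite Q"
proof (rule finite_subset)
  show "Q \<subseteq> (\<lambda>g. g e) ` G" using transitive[OF e_in] by blast
qed (use assms in simp)

lemma latin_iff_left_translations_inj:
  assumes "finite G"
  shows "latin_quandle Q op \<longleftrightarrow> (\<forall>x\<in>Q. inj_on (op x) Q)"
proof -
  have "bij_betw (op x) Q Q \<longleftrightarrow> inj_on (op x) Q" if "x \<in> Q" for x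
    using that finite_carrier[OF assms] endo_inj_surj[of Q "op x"]
    by (auto simp: bij_betw_def image_subset_iff)
  then show ?thesis by (simp add: latin_quandle_def quandle_op)
qed

end

theorem proposition6p3:
  fixes Q :: "'a set" and e :: 'a and G :: "('a \<Rightarrow> 'a) set" and \<zeta> :: "'a \<Rightarrow> 'a"
  assumes "quandle_envelope Q e G \<zeta>"
    and "finite G"
  shows "latin_quandle Q (envelope_op Q e G \<zeta>) \<longleftrightarrow>
         (\<forall>\<alpha> \<in> G - point_stabilizer Q G e.
            \<forall>x\<in>Q. commutator (perm_group Q G) \<zeta> \<alpha> x \<noteq> x)"
proof -
  interpret envelope Q e G \<zeta> by standard fact
  show ?thesis
    using latin_iff_left_translations_inj[OF assms(2)] left_translations_inj_iff by simp
qed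

end
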